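(* Let $\mathbf{V}$ be a bullet idempotent variety of finite monoids, i.e. $\mathbf{V}=\mathrm{Rees}(\mathbf{V},\mathbf{V})$, and let $\mathbf{H}=\mathbf{V}\cap\mathbf{G}$, where $\mathbf{G}$ is the class of all finite groups. Then $\mathbf{V}=\overline{\mathbf{H}}$.
   Context: A monoid $N$ is a divisor of a monoid $M$ if $N$ is a homomorphic image of a subsemigroup of $M$. A variety of finite monoids is a class of finite monoids closed under finite direct products (including the empty product, the trivial monoid) and under divisors. A variety of finite groups is a variety of finite monoids containing only groups. For a variety $\mathbf{H}$ of finite groups, $\overline{\mathbf{H}}$ is the variety of all finite monoids $M$ such that every subgroup of $M$ (subsemigroup which is a group) belongs to $\mathbf{H}$. For monoids $N,L$ and any mapping $\rho:N\to L$, the Rees extension $\mathrm{Rees}(N,L,\rho)$ is the set $N\cup (N\times L\times N)$ with multiplication: $n\cdot n'=nn'$; $n\cdot(n_1,m,n_2)\cdot n'=(nn_1,m,n_2n')$; $(n_1,m,n_2)\cdot(n_1',m',n_2')=(n_1,m\,\rho(n_2n_1')\,m',n_2')$, for $n,n',n_1,n_2,n_1',n_2'\in N$, $m,m'\in L$. For varieties of finite monoids $\mathbf{U},\mathbf{V}$, $\mathrm{Rees}(\mathbf{U},\mathbf{V})$ denotes the variety of finite monoids generated by all Rees extensions $\mathrm{Rees}(N,M,\rho)$ with $N\in\mathbf{U}$, $M\in\mathbf{V}$ and $\rho:N\to M$ any mapping. *)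

theory Defs
  imports "HOL-Algebra.Product_Groups"
begin

definition finite_monoid :: "('a, 'm) monoid_scheme \<Rightarrow> bool" where
  "finite_monoid M \<longleftrightarrow> monoid M \<and> finite (carrier M)"

text \<open>
  A subsemigroup need not contain the unit of the ambient monoid. The empty set is harmless here:
  it has no monoid as homomorphic image and does not carry a group structure.
\<close>

definition subsemigroup :: "'a set \<Rightarrow> ('a, 'm) monoid_scheme \<Rightarrow> bool" where
  "subsemigroup S M \<longleftrightarrow> S \<subseteq> carrier M \<and> (\<forall>x\<in>S. \<forall>y\<in>S. x \<otimes>\<^bsub>M\<^esub> y \<in> S)"

text \<open>
  Homomorphisms of \<^const>\<open>epi\<close> only respect the multiplication, so the value of the unit field
  of \<open>M\<lparr>carrier := S\<rparr>\<close> is irrelevant.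
\<close>

definition divides_monoid ::
    "('a, 'm) monoid_scheme \<Rightarrow> ('b, 'n) monoid_scheme \<Rightarrow> bool" where
  "divides_monoid N M \<longleftrightarrow>
     monoid N \<and> monoid M \<and> (\<exists>S h. subsemigroup S M \<and> h \<in> epi (M\<lparr>carrier := S\<rparr>) N)"

text \<open>
  Every finite monoid is isomorphic to one whose carrier is a set of natural numbers. A class of
  finite monoids closed under isomorphism is therefore represented by its members on the
  type \<^typ>\<open>nat monoid\<close>; monoids on other types belong to the class up to isomorphism.
  Closure of varieties under isomorphism is an instance of closure under divisors.
\<close>

definition belongs_to :: "('a, 'm) monoid_scheme \<Rightarrow> nat monoid set \<Rightarrow> bool" where
  "belongs_to M V \<longleftrightarrow> (\<exists>N\<in>V. M \<cong> N)"

text \<open>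
  The library constant \<^const>\<open>product_group\<close> is the direct product of a family of arbitrary
  monoids. For \<open>n = 0\<close> it is the trivial monoid.
\<close>

definition monoid_variety :: "nat monoid set \<Rightarrow> bool" where
  "monoid_variety V \<longleftrightarrow>
     (\<forall>M\<in>V. finite_monoid M) \<and>
     (\<forall>(n::nat) F. (\<forall>i<n. F i \<in> V) \<longrightarrow> belongs_to (product_group {..<n} F) V) \<and>
     (\<forall>M\<in>V. \<forall>N. divides_monoid N M \<longrightarrow> N \<in> V)"

text \<open>
  For finite generating monoids the intersection is not empty: the class of all finite monoids
  is a variety.
\<close>

definition variety_generated_by :: "'a monoid set \<Rightarrow> nat monoid set" where
  "variety_generated_by C = \<Inter>{W. monoid_variety W \<and> (\<forall>M\<in>C. belongs_to M W)}"

fun rees_mult ::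
    "('a, 'm) monoid_scheme \<Rightarrow> ('b, 'n) monoid_scheme \<Rightarrow> ('a \<Rightarrow> 'b) \<Rightarrow>
     'a + 'a \<times> 'b \<times> 'a \<Rightarrow> 'a + 'a \<times> 'b \<times> 'a \<Rightarrow> 'a + 'a \<times> 'b \<times> 'a" where
  "rees_mult N L \<rho> (Inl n) (Inl n') = Inl (n \<otimes>\<^bsub>N\<^esub> n')"
| "rees_mult N L \<rho> (Inl n) (Inr (n1, m, n2)) = Inr (n \<otimes>\<^bsub>N\<^esub> n1, m, n2)"
| "rees_mult N L \<rho> (Inr (n1, m, n2)) (Inl n') = Inr (n1, m, n2 \<otimes>\<^bsub>N\<^esub> n')"
| "rees_mult N L \<rho> (Inr (n1, m, n2)) (Inr (n1', m', n2')) =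
     Inr (n1, m \<otimes>\<^bsub>L\<^esub> \<rho> (n2 \<otimes>\<^bsub>N\<^esub> n1') \<otimes>\<^bsub>L\<^esub> m', n2')"

definition Rees ::
    "('a, 'm) monoid_scheme \<Rightarrow> ('b, 'n) monoid_scheme \<Rightarrow> ('a \<Rightarrow> 'b) \<Rightarrow>
     ('a + 'a \<times> 'b \<times> 'a) monoid" where
  "Rees N L \<rho> =
     \<lparr>carrier = Inl ` carrier N \<union> Inr ` (carrier N \<times> carrier L \<times> carrier N),
      mult = rees_mult N L \<rho>,
      one = Inl \<one>\<^bsub>N\<^esub>\<rparr>"

definition Rees_variety :: "nat monoid set \<Rightarrow> nat monoid set \<Rightarrow> nat monoid set" where
  "Rees_variety U V =
     variety_generated_by
       {Rees N M \<rho> | N M \<rho>. N \<in> U \<and> M \<in> V \<and> \<rho> \<in> carrier N \<rightarrow> carrier M}"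

definition bullet_idempotent :: "nat monoid set \<Rightarrow> bool" where
  "bullet_idempotent V \<longleftrightarrow> V = Rees_variety V V"

definition finite_groups :: "nat monoid set" where
  "finite_groups = {G. group G \<and> finite (carrier G)}"

text \<open>
  A subsemigroup that is a group may have a unit \<open>e\<close> different from the unit of \<open>M\<close>.
\<close>

definition overline_class :: "nat monoid set \<Rightarrow> nat monoid set" where
  "overline_class H =
     {M. finite_monoid M \<and>
         (\<forall>S e. subsemigroup S M \<and> group (M\<lparr>carrier := S, one := e\<rparr>) \<longrightarrow>
                M\<lparr>carrier := S, one := e\<rparr> \<in> H)}"

end

theory Submission
  imports Defs
begin

text \<open>
  A finite monoid \<open>M\<close> that is not a group is generated by a maximal proper submonoid \<open>N\<close> containing
  the units together with any \<open>c\<close> outside \<open>N\<close>. On \<open>cM \<inter> Mc\<close> the multiplication \<open>xc \<circ> cy = xcy\<close>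
  defines a monoid with unit \<open>c\<close>, the local divisor at \<open>c\<close>. Both \<open>N\<close> and the local divisor are smaller
  divisors of \<open>M\<close>, and \<open>(n, m, n') \<mapsto> n m n'\<close> is a homomorphism from the Rees extension with
  \<open>\<rho>(n) = c n c\<close> onto \<open>M\<close>. By induction on the size of \<open>M\<close>, a finite monoid belongs to \<open>V\<close> as soon as
  every group dividing it does. Finally, a group dividing \<open>M\<close> is an image of a subgroup of \<open>M\<close>.
\<close>

section \<open>Divisors of monoids\<close>

text \<open>Pull \<open>S\<close> back along \<open>k\<close>: the preimage \<open>U\<close> is a
  subsemigroup of \<open>M\<close>, and \<open>h \<circ> k\<close> maps it onto
  \<open>G\<close>.\<close>

lemma divides_monoid_trans:
  assumes "divides_monoid G N" and "divides_monoid N M"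
  shows "divides_monoid G M"
proof -
  obtain S h where S: "subsemigroup S N" and h: "h \<in> epi (N\<lparr>carrier := S\<rparr>) G"
    using assms(1) by (auto simp: divides_monoid_def)
  obtain T k where T: "subsemigroup T M" and k: "k \<in> epi (M\<lparr>carrier := T\<rparr>) N"
    using assms(2) by (auto simp: divides_monoid_def)
  define U where "U = {t \<in> T. k t \<in> S}"
  have kmult: "k (x \<otimes>\<^bsub>M\<^esub> y) = k x \<otimes>\<^bsub>N\<^esub> k y" if "x \<in> T" "y \<in> T" for x y
    using k that by (auto simp: epi_def hom_def)
  have hmult: "h (x \<otimes>\<^bsub>N\<^esub> y) = h x \<otimes>\<^bsub>G\<^esub> h y" if "x \<in> S" "y \<in> S" for x y
    using h that by (auto simp: epi_def hom_def)
  have "k ` U = S"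
    using k S by (auto simp: epi_def U_def subsemigroup_def)
  moreover have "h ` S = carrier G"
    using h by (auto simp: epi_def)
  ultimately have img: "(h \<circ> k) ` U = carrier G"
    by (metis image_comp)
  have "subsemigroup U M"
    using S T kmult by (auto simp: U_def subsemigroup_def)
  moreover have "h \<circ> k \<in> epi (M\<lparr>carrier := U\<rparr>) G"
    using img by (auto simp: epi_def hom_def U_def kmult hmult)
  ultimately show ?thesis
    using assms by (auto simp: divides_monoid_def)
qed

lemma epi_divides_monoid:
  assumes "\<phi> \<in> epi R M" "monoid R" "monoid M"
  shows "divides_monoid M R"
proof -
  have "subsemigroup (carrier R) R"
    using monoid.m_closed[OF assms(2)] by (auto simp: subsemigroup_def)
  moreover have "\<phi> \<in> epi (R\<lparr>carrier := carrier R\<rparr>) M"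
    using assms(1) by (simp add: epi_def hom_def)
  ultimately show ?thesis
    using assms unfolding divides_monoid_def by blast
qed

text \<open>The identity serves as epimorphism even if \<open>e\<close> differs from the unit of
  \<open>M\<close>, because \<open>epi\<close> does not look at units.\<close>

lemma divides_monoid_subsemigroup:
  assumes "monoid M" "subsemigroup S M" "monoid (M\<lparr>carrier := S, one := e\<rparr>)"
  shows "divides_monoid (M\<lparr>carrier := S, one := e\<rparr>) M"
proof -
  have "id \<in> epi (M\<lparr>carrier := S\<rparr>) (M\<lparr>carrier := S, one := e\<rparr>)"
    by (auto simp: epi_def hom_def)
  then show ?thesis
    using assms by (auto simp: divides_monoid_def)
qed

section \<open>Lifting a group divisor to a subgroup\<close>

text \<open>Solvability of \<open>t x = y\<close> and \<open>x t = y\<close> inside \<open>T\<close>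
  gives the group axioms. A right unit \<open>e\<close> of one element \<open>t\<close> is a right
  unit of every \<open>x t\<close>, hence of all of \<open>T\<close>; dually for a left unit
  \<open>f\<close>. Then \<open>f = f e = e\<close>, and left inverses come from solving
  \<open>x t = e\<close>.\<close>

lemma (in monoid) group_if_translations_surj:
  assumes T: "subsemigroup T G" and "T \<noteq> {}"
    and left: "\<And>t. t \<in> T \<Longrightarrow> (\<lambda>x. t \<otimes> x) ` T = T"
    and right: "\<And>t. t \<in> T \<Longrightarrow> (\<lambda>x. x \<otimes> t) ` T = T"
  shows "\<exists>e. group (G\<lparr>carrier := T, one := e\<rparr>)"
proof -
  have sub: "\<And>x. x \<in> T \<Longrightarrow> x \<in> carrier G"
    and closed: "\<And>x y. x \<in> T \<Longrightarrow> y \<in> T \<Longrightarrow> x \<otimes> y \<in> T"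
    using T by (auto simp: subsemigroup_def)
  have lsolve: "\<exists>x\<in>T. y = t \<otimes> x" and rsolve: "\<exists>x\<in>T. y = x \<otimes> t" if "t \<in> T" "y \<in> T" for t y
    using left[OF that(1)] right[OF that(1)] that(2) by blast+
  obtain t where t: "t \<in> T"
    using \<open>T \<noteq> {}\<close> by blast
  obtain e where e: "e \<in> T" "t = t \<otimes> e"
    using lsolve t by blast
  obtain f where f: "f \<in> T" "t = f \<otimes> t"
    using rsolve t by blast
  have re: "y \<otimes> e = y" if y: "y \<in> T" for y
  proof -
    obtain x where "x \<in> T" "y = x \<otimes> t"
      using rsolve t y by blast
    then show ?thesis
      using e t sub by (metis m_assoc)
  qed
  have lf: "f \<otimes> y = y" if y: "y \<in> T" for y
  proof -
    obtain x where "x \<in> T" "y = t \<otimes> x"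
      using lsolve t y by blast
    then show ?thesis
      using f t sub by (metis m_assoc)
  qed
  have "f = e"
    using re[OF f(1)] lf[OF e(1)] by simp
  then have "group (G\<lparr>carrier := T, one := e\<rparr>)"
    using e closed lf rsolve by (intro groupI) (fastforce simp: m_assoc sub)+
  then show ?thesis ..
qed

text \<open>
  The subgroup is a minimal subsemigroup mapped onto \<open>G\<close>: its translates are subsemigroups
  that are also mapped onto \<open>G\<close>.
\<close>

lemma group_divisor_lifts:
  assumes M: "finite_monoid M" and G: "group G" and div: "divides_monoid G M"
  obtains T e where "subsemigroup T M" "group (M\<lparr>carrier := T, one := e\<rparr>)"
    "divides_monoid G (M\<lparr>carrier := T, one := e\<rparr>)"
proof -
  interpret M: monoid M
    using M by (simp add: finite_monoid_def)
  interpret G: group G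
    by (rule G)
  obtain S h where S: "subsemigroup S M" and h: "h \<in> epi (M\<lparr>carrier := S\<rparr>) G"
    using div by (auto simp: divides_monoid_def)
  have hmult: "h (x \<otimes>\<^bsub>M\<^esub> y) = h x \<otimes>\<^bsub>G\<^esub> h y" if "x \<in> S" "y \<in> S" for x y
    using h that by (auto simp: epi_def hom_def)
  define Q where "Q = {T. T \<subseteq> S \<and> subsemigroup T M \<and> h ` T = carrier G}"
  have "finite (Pow (carrier M))"
    using M by (simp add: finite_monoid_def)
  moreover have "Q \<subseteq> Pow (carrier M)"
    by (auto simp: Q_def subsemigroup_def)
  ultimately have "finite Q"
    by (rule rev_finite_subset)
  moreover have "S \<in> Q"
    using S h by (auto simp: Q_def epi_def)
  ultimately obtain T where T: "T \<in> Q" and min: "\<And>U. U \<in> Q \<Longrightarrow> U \<subseteq> T \<Longrightarrow> T = U"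
    using finite_has_minimal[of Q] by blast
  have TS: "T \<subseteq> S" and Tsub: "subsemigroup T M" and Timg: "h ` T = carrier G"
    using T by (auto simp: Q_def)
  have Tc: "\<And>x. x \<in> T \<Longrightarrow> x \<in> carrier M"
    and Tm: "\<And>x y. x \<in> T \<Longrightarrow> y \<in> T \<Longrightarrow> x \<otimes>\<^bsub>M\<^esub> y \<in> T"
    using Tsub by (auto simp: subsemigroup_def)
  have Thm: "h (x \<otimes>\<^bsub>M\<^esub> y) = h x \<otimes>\<^bsub>G\<^esub> h y" if "x \<in> T" "y \<in> T" for x y
    using TS hmult that by blast
  have left: "(\<lambda>x. t \<otimes>\<^bsub>M\<^esub> x) ` T = T" if t: "t \<in> T" for t
  proof -
    let ?U = "(\<lambda>x. t \<otimes>\<^bsub>M\<^esub> x) ` T"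
    have ht: "h t \<in> carrier G"
      using t Timg by blast
    \<comment> \<open>The image of the translate is the coset \<open>h(t) G\<close>, which is all of
      \<open>G\<close>.\<close>
    have "h ` ?U = (\<lambda>g. h t \<otimes>\<^bsub>G\<^esub> g) ` (h ` T)"
      unfolding image_image using t Thm by (intro image_cong) auto
    also have "\<dots> = carrier G"
      unfolding Timg using ht by (rule G.surj_const_mult)
    finally have "h ` ?U = carrier G" .
    moreover have "subsemigroup ?U M"
      unfolding subsemigroup_def
    proof (intro conjI ballI)
      show "?U \<subseteq> carrier M"
        using t Tc Tm by blast
      fix x y assume "x \<in> ?U" "y \<in> ?U"
      then obtain a b where "a \<in> T" "b \<in> T" "x = t \<otimes>\<^bsub>M\<^esub> a" "y = t \<otimes>\<^bsub>M\<^esub> b"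
        by blast
      \<comment> \<open>\<open>(t a)(t b) = t (a (t b))\<close> is again a left translate by
        \<open>t\<close>.\<close>
      then show "x \<otimes>\<^bsub>M\<^esub> y \<in> ?U"
        using t Tc Tm by (intro image_eqI[of _ _ "a \<otimes>\<^bsub>M\<^esub> (t \<otimes>\<^bsub>M\<^esub> b)"]) (auto simp: M.m_assoc)
    qed
    moreover have "?U \<subseteq> T"
      using t Tm by blast
    ultimately show ?thesis
      using min[of ?U] TS by (auto simp: Q_def)
  qed
  have right: "(\<lambda>x. x \<otimes>\<^bsub>M\<^esub> t) ` T = T" if t: "t \<in> T" for t
  proof -
    let ?U = "(\<lambda>x. x \<otimes>\<^bsub>M\<^esub> t) ` T"
    have ht: "h t \<in> carrier G"
      using t Timg by blast
    have "h ` ?U = (\<lambda>g. g \<otimes>\<^bsub>G\<^esub> h t) ` (h ` T)"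
      unfolding image_image using t Thm by (intro image_cong) auto
    also have "\<dots> = carrier G"
      unfolding Timg
    proof (intro equalityI subsetI)
      fix g assume "g \<in> carrier G"
      then show "g \<in> (\<lambda>g. g \<otimes>\<^bsub>G\<^esub> h t) ` carrier G"
        using ht by (intro image_eqI[of _ _ "g \<otimes>\<^bsub>G\<^esub> inv\<^bsub>G\<^esub> h t"]) (auto simp: G.m_assoc)
    qed (use ht in auto)
    finally have "h ` ?U = carrier G" .
    moreover have "subsemigroup ?U M"
      unfolding subsemigroup_def
    proof (intro conjI ballI)
      show "?U \<subseteq> carrier M"
        using t Tc Tm by blast
      fix x y assume "x \<in> ?U" "y \<in> ?U"
      then obtain a b where "a \<in> T" "b \<in> T" "x = a \<otimes>\<^bsub>M\<^esub> t" "y = b \<otimes>\<^bsub>M\<^esub> t"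
        by blast
      then show "x \<otimes>\<^bsub>M\<^esub> y \<in> ?U"
        using t Tc Tm by (intro image_eqI[of _ _ "a \<otimes>\<^bsub>M\<^esub> t \<otimes>\<^bsub>M\<^esub> b"]) (auto simp: M.m_assoc)
    qed
    moreover have "?U \<subseteq> T"
      using t Tm by blast
    ultimately show ?thesis
      using min[of ?U] TS by (auto simp: Q_def)
  qed
  have "T \<noteq> {}"
    using Timg G.one_closed by blast
  then obtain e where e: "group (M\<lparr>carrier := T, one := e\<rparr>)"
    using M.group_if_translations_surj[OF Tsub _ left right] by blast
  have "h \<in> epi (M\<lparr>carrier := T, one := e\<rparr>) G"
    using Timg Thm by (auto simp: epi_def hom_def)
  moreover have "subsemigroup T (M\<lparr>carrier := T, one := e\<rparr>)"
    using Tm by (auto simp: subsemigroup_def)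
  ultimately have "divides_monoid G (M\<lparr>carrier := T, one := e\<rparr>)"
    using e G.is_monoid group.is_monoid[OF e]
    unfolding divides_monoid_def by (intro conjI exI[of _ T] exI[of _ h]) (auto simp: epi_def hom_def)
  with Tsub e show ?thesis
    by (rule that)
qed

section \<open>Rees extensions and local divisors\<close>

lemma Rees_monoid:
  assumes "monoid N" "monoid L" "\<rho> \<in> carrier N \<rightarrow> carrier L"
  shows "monoid (Rees N L \<rho>)"
proof -
  interpret N: monoid N by fact
  interpret L: monoid L by fact
  have \<rho>: "\<And>n. n \<in> carrier N \<Longrightarrow> \<rho> n \<in> carrier L"
    using assms(3) by blast
  show ?thesis
    by (rule monoidI) (auto simp: Rees_def \<rho> N.m_assoc L.m_assoc)
qed

text \<open>The product of \<open>x c\<close> and \<open>c y\<close> is meant to be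
  \<open>x c y\<close>. \<open>SOME\<close> picks a left cofactor \<open>x\<close> of the first
  argument and applies it to the second as a whole, so no cofactor \<open>y\<close> has to be
  chosen.\<close>

definition local_divisor :: "('a, 'm) monoid_scheme \<Rightarrow> 'a \<Rightarrow> 'a monoid" where
  "local_divisor M c =
     \<lparr>carrier = (\<lambda>x. c \<otimes>\<^bsub>M\<^esub> x) ` carrier M \<inter> (\<lambda>x. x \<otimes>\<^bsub>M\<^esub> c) ` carrier M,
      mult = (\<lambda>m m'. (SOME x. x \<in> carrier M \<and> m = x \<otimes>\<^bsub>M\<^esub> c) \<otimes>\<^bsub>M\<^esub> m'),
      one = c\<rparr>"

context monoid
begin

lemma local_divisor_carrier:
  "m \<in> carrier (local_divisor G c) \<longleftrightarrow>
     (\<exists>x\<in>carrier G. m = c \<otimes> x) \<and> (\<exists>x\<in>carrier G. m = x \<otimes> c)"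
  by (auto simp: local_divisor_def)

lemma local_divisorE:
  assumes "m \<in> carrier (local_divisor G c)"
  obtains x y where "x \<in> carrier G" "y \<in> carrier G" "m = x \<otimes> c" "m = c \<otimes> y"
  using assms by (auto simp: local_divisor_def)

lemma local_divisor_subset:
  assumes "c \<in> carrier G"
  shows "carrier (local_divisor G c) \<subseteq> carrier G"
  using assms by (auto simp: local_divisor_def)

text \<open>Independence of the chosen cofactor: \<open>x' c = x c\<close> implies
  \<open>x' (c y) = x (c y)\<close>.\<close>

lemma local_divisor_mult:
  assumes "c \<in> carrier G" "x \<in> carrier G" "y \<in> carrier G" "m \<in> carrier (local_divisor G c)"
    and "m = x \<otimes> c" and "m' = c \<otimes> y"
  shows "m \<otimes>\<^bsub>local_divisor G c\<^esub> m' = x \<otimes> c \<otimes> y"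
proof -
  define x' where "x' = (SOME x. x \<in> carrier G \<and> m = x \<otimes> c)"
  have "x' \<in> carrier G \<and> m = x' \<otimes> c"
    unfolding x'_def by (rule someI[of _ x]) (use assms in simp)
  then have "x' \<otimes> m' = x \<otimes> c \<otimes> y"
    using assms by (metis m_assoc)
  then show ?thesis
    by (simp add: local_divisor_def x'_def)
qed

text \<open>Each element has a form \<open>x c\<close> and a form \<open>c x'\<close>. For
  \<open>m = x c = c x'\<close> and \<open>m' = y' c = c y\<close> the product \<open>x c y\<close>
  equals both \<open>(x y') c\<close> and \<open>c (x' y)\<close>, so it stays in the carrier. These
  two forms also yield associativity.\<close>

lemma local_divisor_monoid:
  assumes c: "c \<in> carrier G"
  shows "monoid (local_divisor G c)"
proof (rule monoidI)
  let ?L = "local_divisor G c"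
  have closed_l: "\<exists>z\<in>carrier G. m \<otimes>\<^bsub>?L\<^esub> m' = z \<otimes> c"
    if m: "m \<in> carrier ?L" "m' \<in> carrier ?L" for m m'
  proof -
    obtain x x' where m1: "x \<in> carrier G" "x' \<in> carrier G" "m = x \<otimes> c" "m = c \<otimes> x'"
      using m(1) by (rule local_divisorE)
    obtain y' y where m2: "y' \<in> carrier G" "y \<in> carrier G" "m' = y' \<otimes> c" "m' = c \<otimes> y"
      using m(2) by (rule local_divisorE)
    note * = m1 m2
    have "m \<otimes>\<^bsub>?L\<^esub> m' = x \<otimes> c \<otimes> y"
      using local_divisor_mult[OF c _ _ m(1)] * by blast
    then have "m \<otimes>\<^bsub>?L\<^esub> m' = (x \<otimes> y') \<otimes> c"
      using * c by (metis m_assoc)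
    then show ?thesis
      using * by blast
  qed
  have closed_r: "\<exists>z\<in>carrier G. m \<otimes>\<^bsub>?L\<^esub> m' = c \<otimes> z"
    if m: "m \<in> carrier ?L" "m' \<in> carrier ?L" for m m'
  proof -
    obtain x x' where m1: "x \<in> carrier G" "x' \<in> carrier G" "m = x \<otimes> c" "m = c \<otimes> x'"
      using m(1) by (rule local_divisorE)
    obtain y' y where m2: "y' \<in> carrier G" "y \<in> carrier G" "m' = y' \<otimes> c" "m' = c \<otimes> y"
      using m(2) by (rule local_divisorE)
    note * = m1 m2
    have "m \<otimes>\<^bsub>?L\<^esub> m' = x \<otimes> c \<otimes> y"
      using local_divisor_mult[OF c _ _ m(1)] * by blast
    then have "m \<otimes>\<^bsub>?L\<^esub> m' = c \<otimes> (x' \<otimes> y)"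
      using * c by (metis m_assoc)
    then show ?thesis
      using * by blast
  qed
  show closed: "m \<otimes>\<^bsub>?L\<^esub> m' \<in> carrier ?L" if "m \<in> carrier ?L" "m' \<in> carrier ?L" for m m'
    using closed_l[OF that] closed_r[OF that] by (simp add: local_divisor_carrier)
  have one: "\<one>\<^bsub>?L\<^esub> = c"
    by (simp add: local_divisor_def)
  have "c = c \<otimes> \<one>" "c = \<one> \<otimes> c"
    using c by auto
  then show c_in: "\<one>\<^bsub>?L\<^esub> \<in> carrier ?L"
    unfolding one local_divisor_carrier by blast
  show "\<one>\<^bsub>?L\<^esub> \<otimes>\<^bsub>?L\<^esub> m = m" if m: "m \<in> carrier ?L" for m
  proof -
    obtain x where "x \<in> carrier G" "m = c \<otimes> x"
      using m by (rule local_divisorE)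
    then show ?thesis
      using local_divisor_mult[OF c one_closed, of x c m] c c_in one by simp
  qed
  show "m \<otimes>\<^bsub>?L\<^esub> \<one>\<^bsub>?L\<^esub> = m" if m: "m \<in> carrier ?L" for m
  proof -
    obtain x where "x \<in> carrier G" "m = x \<otimes> c"
      using m by (rule local_divisorE)
    then show ?thesis
      using local_divisor_mult[OF c _ one_closed m, of x c] c one by simp
  qed
  show "m \<otimes>\<^bsub>?L\<^esub> m' \<otimes>\<^bsub>?L\<^esub> m'' = m \<otimes>\<^bsub>?L\<^esub> (m' \<otimes>\<^bsub>?L\<^esub> m'')"
    if m: "m \<in> carrier ?L" "m' \<in> carrier ?L" "m'' \<in> carrier ?L" for m m' m''
  proof -
    obtain x x' where m1: "x \<in> carrier G" "x' \<in> carrier G" "m = x \<otimes> c" "m = c \<otimes> x'"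
      using m(1) by (rule local_divisorE)
    obtain y' y where m2: "y' \<in> carrier G" "y \<in> carrier G" "m' = y' \<otimes> c" "m' = c \<otimes> y"
      using m(2) by (rule local_divisorE)
    obtain z' z where m3: "z' \<in> carrier G" "z \<in> carrier G" "m'' = z' \<otimes> c" "m'' = c \<otimes> z"
      using m(3) by (rule local_divisorE)
    note * = m1 m2 m3
    have "m \<otimes>\<^bsub>?L\<^esub> m' = x \<otimes> c \<otimes> y"
      using local_divisor_mult c m(1) m1 m2 by blast
    then have 1: "m \<otimes>\<^bsub>?L\<^esub> m' = (x \<otimes> y') \<otimes> c"
      using * c by (metis m_assoc)
    have "m' \<otimes>\<^bsub>?L\<^esub> m'' = y' \<otimes> c \<otimes> z"
      using local_divisor_mult c m * by blast
    then have 2: "m' \<otimes>\<^bsub>?L\<^esub> m'' = c \<otimes> (y \<otimes> z)"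
      using * c by (metis m_assoc)
    have "m \<otimes>\<^bsub>?L\<^esub> m' \<otimes>\<^bsub>?L\<^esub> m'' = (x \<otimes> y') \<otimes> c \<otimes> z"
      using local_divisor_mult[OF c _ _ closed[OF m(1,2)] 1] * by blast
    also have "\<dots> = x \<otimes> (y' \<otimes> c) \<otimes> z"
      using m1(1) m2(1) m3(2) c by (simp add: m_assoc)
    \<comment> \<open>The two bracketings meet here: both forms of the middle factor
      \<open>m'\<close> are used.\<close>
    also have "\<dots> = x \<otimes> (c \<otimes> y) \<otimes> z"
      using m2(3,4) by simp
    also have "\<dots> = x \<otimes> c \<otimes> (y \<otimes> z)"
      using m1(1) m2(2) m3(2) c by (simp add: m_assoc)
    also have "\<dots> = m \<otimes>\<^bsub>?L\<^esub> (m' \<otimes>\<^bsub>?L\<^esub> m'')"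
      using local_divisor_mult[OF c m1(1) _ m(1) m1(3) 2] m2(2) m3(2) by simp
    finally show ?thesis .
  qed
qed

text \<open>This makes \<open>n \<mapsto> c n c\<close> an admissible map \<rho> into the local
  divisor.\<close>

lemma local_divisor_sandwich:
  assumes "c \<in> carrier G" "n \<in> carrier G"
  shows "c \<otimes> n \<otimes> c \<in> carrier (local_divisor G c)"
proof -
  have "c \<otimes> n \<otimes> c = c \<otimes> (n \<otimes> c)"
    using assms by (simp add: m_assoc)
  then show ?thesis
    unfolding local_divisor_carrier using assms by blast
qed

text \<open>Left multiplication by \<open>c\<close> is the epimorphism, defined on those
  \<open>x\<close> for which \<open>c x\<close> also lies in \<open>M c\<close>. If
  \<open>c x = a c\<close>, then \<open>c (x y) = a c y\<close>, which is the product of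
  \<open>c x\<close> and \<open>c y\<close> in the local divisor.\<close>

lemma local_divisor_divides:
  assumes c: "c \<in> carrier G"
  shows "divides_monoid (local_divisor G c) G"
proof -
  let ?L = "local_divisor G c"
  define S where "S = {x \<in> carrier G. c \<otimes> x \<in> carrier ?L}"
  have S_iff: "x \<in> S \<longleftrightarrow> x \<in> carrier G \<and> (\<exists>z\<in>carrier G. c \<otimes> x = z \<otimes> c)" for x
    by (auto simp: S_def local_divisor_carrier)
  have S: "subsemigroup S G"
    unfolding subsemigroup_def
  proof (intro conjI ballI)
    fix x y assume "x \<in> S" "y \<in> S"
    then obtain a b where *: "x \<in> carrier G" "y \<in> carrier G" "a \<in> carrier G" "b \<in> carrier G"
      "c \<otimes> x = a \<otimes> c" "c \<otimes> y = b \<otimes> c"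
      by (auto simp: S_iff)
    then have "c \<otimes> (x \<otimes> y) = a \<otimes> b \<otimes> c"
      using c by (metis m_assoc)
    then show "x \<otimes> y \<in> S"
      using * S_iff by blast
  qed (auto simp: S_iff)
  have "c \<otimes> (x \<otimes> y) = (c \<otimes> x) \<otimes>\<^bsub>?L\<^esub> (c \<otimes> y)" if xy: "x \<in> S" "y \<in> S" for x y
  proof -
    obtain a where *: "x \<in> carrier G" "y \<in> carrier G" "a \<in> carrier G" "c \<otimes> x = a \<otimes> c"
      using xy by (auto simp: S_iff)
    have "c \<otimes> x \<in> carrier ?L"
      using xy by (simp add: S_def)
    then have "(c \<otimes> x) \<otimes>\<^bsub>?L\<^esub> (c \<otimes> y) = a \<otimes> c \<otimes> y"
      using local_divisor_mult c * by blast
    then show ?thesis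
      using * c by (metis m_assoc)
  qed
  moreover have "(\<lambda>x. c \<otimes> x) ` S = carrier ?L"
  proof (intro equalityI subsetI)
    fix m assume m: "m \<in> carrier ?L"
    then obtain y where "y \<in> carrier G" "m = c \<otimes> y"
      by (rule local_divisorE)
    with m show "m \<in> (\<lambda>x. c \<otimes> x) ` S"
      by (intro image_eqI[of _ _ y]) (auto simp: S_def)
  qed (auto simp: S_def)
  ultimately have "(\<lambda>x. c \<otimes> x) \<in> epi (G\<lparr>carrier := S\<rparr>) ?L"
    by (auto simp: epi_def hom_def)
  then show ?thesis
    using S local_divisor_monoid[OF c] monoid_axioms by (auto simp: divides_monoid_def)
qed

text \<open>The unit of the monoid is missing: \<open>c x = 1 = y c\<close> would make
  \<open>c\<close> invertible.\<close>

lemma local_divisor_proper: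
  assumes c: "c \<in> carrier G" "c \<notin> Units G"
  shows "carrier (local_divisor G c) \<subset> carrier G"
proof -
  have "\<one> \<notin> carrier (local_divisor G c)"
  proof
    assume "\<one> \<in> carrier (local_divisor G c)"
    then obtain x y where *: "x \<in> carrier G" "\<one> = c \<otimes> x" "y \<in> carrier G" "\<one> = y \<otimes> c"
      by (auto simp: local_divisor_carrier)
    then have "y = x"
      using c inv_unique by metis
    with * c show False
      by (auto simp: Units_def)
  qed
  then show ?thesis
    using local_divisor_subset[OF c(1)] one_closed by blast
qed

section \<open>The Rees extension mapping onto the monoid\<close>

text \<open>The choice of \<rho> is governed by one identity: in the local divisor, the product of
  \<open>m\<close>, \<open>c n c\<close> and \<open>m'\<close> is \<open>m n m'\<close>. For
  \<open>n = n2 n1'\<close> this turns the product of two triples into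
  \<open>(n1 m n2)(n1' m' n2')\<close>.\<close>

lemma Rees_local_divisor_hom:
  assumes N: "submonoid N G" and c: "c \<in> carrier G"
  defines "\<phi> \<equiv> case_sum id (\<lambda>(n, m, n'). n \<otimes> m \<otimes> n')"
  defines "R \<equiv> Rees (G\<lparr>carrier := N\<rparr>) (local_divisor G c) (\<lambda>n. c \<otimes> n \<otimes> c)"
  shows "\<phi> \<in> hom R G"
proof (rule homI)
  let ?L = "local_divisor G c"
  have NG: "\<And>x. x \<in> N \<Longrightarrow> x \<in> carrier G"
    using submonoid.mem_carrier[OF N] .
  have LG: "\<And>x. x \<in> carrier ?L \<Longrightarrow> x \<in> carrier G"
    using local_divisor_subset[OF c] by blast
  show "\<phi> u \<in> carrier G" if "u \<in> carrier R" for u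
    using that by (auto simp: R_def Rees_def \<phi>_def NG LG)
  have sandwich: "m \<otimes>\<^bsub>?L\<^esub> (c \<otimes> n \<otimes> c) \<otimes>\<^bsub>?L\<^esub> m' = m \<otimes> n \<otimes> m'"
    if m: "m \<in> carrier ?L" "m' \<in> carrier ?L" and n: "n \<in> carrier G" for m n m'
  proof -
    have cnc: "c \<otimes> n \<otimes> c \<in> carrier ?L"
      by (rule local_divisor_sandwich[OF c n])
    obtain x x' where m1: "x \<in> carrier G" "x' \<in> carrier G" "m = x \<otimes> c" "m = c \<otimes> x'"
      using m(1) by (rule local_divisorE)
    obtain y' y where m2: "y' \<in> carrier G" "y \<in> carrier G" "m' = y' \<otimes> c" "m' = c \<otimes> y"
      using m(2) by (rule local_divisorE)
    note * = m1 m2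
    \<comment> \<open>The right factor is read as \<open>c (n c)\<close>, with right cofactor
      \<open>n c\<close>.\<close>
    have "m \<otimes>\<^bsub>?L\<^esub> (c \<otimes> n \<otimes> c) = x \<otimes> c \<otimes> (n \<otimes> c)"
      using local_divisor_mult[OF c m1(1) _ m(1) m1(3)] c n by (simp add: m_assoc)
    then have eq: "m \<otimes>\<^bsub>?L\<^esub> (c \<otimes> n \<otimes> c) = m \<otimes> n \<otimes> c"
      using * c n by (simp add: m_assoc)
    have "m \<otimes>\<^bsub>?L\<^esub> (c \<otimes> n \<otimes> c) \<in> carrier ?L"
      using monoid.m_closed[OF local_divisor_monoid[OF c] m(1) cnc] .
    \<comment> \<open>By \<open>eq\<close> the left factor is \<open>(m n) c\<close>, so its left
      cofactor is \<open>m n\<close>.\<close>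
    then have "m \<otimes>\<^bsub>?L\<^esub> (c \<otimes> n \<otimes> c) \<otimes>\<^bsub>?L\<^esub> m' = m \<otimes> n \<otimes> c \<otimes> y"
      using local_divisor_mult[OF c _ m2(2) _ eq m2(4)] LG[OF m(1)] n by simp
    then show ?thesis
      using * c n by (simp add: m_assoc)
  qed
  show "\<phi> (u \<otimes>\<^bsub>R\<^esub> v) = \<phi> u \<otimes> \<phi> v" if uv: "u \<in> carrier R" "v \<in> carrier R" for u v
  proof (cases u; cases v)
    fix a b assume "u = Inl a" "v = Inl b"
    then show ?thesis
      by (simp add: R_def Rees_def \<phi>_def)
  next
    fix a q assume "u = Inl a" "v = Inr q"
    then show ?thesis
      using uv by (cases q) (auto simp: R_def Rees_def \<phi>_def NG LG m_assoc)
  next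
    fix p b assume "u = Inr p" "v = Inl b"
    then show ?thesis
      using uv by (cases p) (auto simp: R_def Rees_def \<phi>_def NG LG m_assoc)
  next
    fix p q assume pq: "u = Inr p" "v = Inr q"
    obtain n1 m n2 where p: "p = (n1, m, n2)"
      by (cases p)
    obtain n1' m' n2' where q: "q = (n1', m', n2')"
      by (cases q)
    have in_N: "n1 \<in> carrier G" "n2 \<in> carrier G" "n1' \<in> carrier G" "n2' \<in> carrier G"
      and m: "m \<in> carrier ?L" "m' \<in> carrier ?L"
      using uv pq p q by (auto simp: R_def Rees_def NG)
    then have "\<phi> (u \<otimes>\<^bsub>R\<^esub> v) = n1 \<otimes> (m \<otimes> (n2 \<otimes> n1') \<otimes> m') \<otimes> n2'"
      unfolding pq p q using sandwich[OF m, of "n2 \<otimes> n1'"] by (simp add: R_def Rees_def \<phi>_def)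
    also have "\<dots> = \<phi> u \<otimes> \<phi> v"
      unfolding pq p q using in_N m LG by (simp add: \<phi>_def m_assoc)
    finally show ?thesis .
  qed
qed

text \<open>The image of the homomorphism is a submonoid. It contains \<open>N\<close>, through the
  left summand, and \<open>c\<close>, so \<open>gen\<close> makes it everything.\<close>

lemma Rees_local_divisor_epi:
  assumes N: "submonoid N G" and c: "c \<in> carrier G"
    and gen: "\<And>K. submonoid K G \<Longrightarrow> N \<subseteq> K \<Longrightarrow> c \<in> K \<Longrightarrow> K = carrier G"
  shows "case_sum id (\<lambda>(n, m, n'). n \<otimes> m \<otimes> n')
    \<in> epi (Rees (G\<lparr>carrier := N\<rparr>) (local_divisor G c) (\<lambda>n. c \<otimes> n \<otimes> c)) G"
    (is "?\<phi> \<in> epi ?R G")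
proof -
  let ?L = "local_divisor G c"
  have hom: "?\<phi> \<in> hom ?R G"
    by (rule Rees_local_divisor_hom[OF N c])
  have one: "\<one> \<in> N"
    by (rule submonoid.one_closed[OF N])
  interpret L: monoid ?L
    by (rule local_divisor_monoid[OF c])
  have cL: "c \<in> carrier ?L"
    using L.one_closed by (simp add: local_divisor_def)
  interpret R: monoid ?R
  proof (rule Rees_monoid)
    show "monoid (G\<lparr>carrier := N\<rparr>)"
      using submonoid.submonoid_is_monoid[OF N monoid_axioms] .
    show "(\<lambda>n. c \<otimes> n \<otimes> c) \<in> carrier (G\<lparr>carrier := N\<rparr>) \<rightarrow> carrier ?L"
      using local_divisor_sandwich[OF c] submonoid.mem_carrier[OF N] by auto
  qed (rule L.monoid_axioms)
  have "?\<phi> ` carrier ?R = carrier G"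
  proof (rule gen)
    show "submonoid (?\<phi> ` carrier ?R) G"
    proof
      show "?\<phi> ` carrier ?R \<subseteq> carrier G"
        using hom by (auto simp: hom_def)
      show "\<one> \<in> ?\<phi> ` carrier ?R"
        using one by (intro image_eqI[of _ _ "Inl \<one>"]) (auto simp: Rees_def)
      show "x \<otimes> y \<in> ?\<phi> ` carrier ?R" if xy: "x \<in> ?\<phi> ` carrier ?R" "y \<in> ?\<phi> ` carrier ?R" for x y
      proof -
        obtain u where u: "x = ?\<phi> u" "u \<in> carrier ?R"
          using xy(1) by (rule imageE)
        obtain v where v: "y = ?\<phi> v" "v \<in> carrier ?R"
          using xy(2) by (rule imageE)
        from u v have "x \<otimes> y = ?\<phi> (u \<otimes>\<^bsub>?R\<^esub> v)"
          using hom_mult[OF hom] by simp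
        moreover have "u \<otimes>\<^bsub>?R\<^esub> v \<in> carrier ?R"
          using u(2) v(2) by (rule R.m_closed)
        ultimately show ?thesis
          by (rule image_eqI)
      qed
    qed
    show "N \<subseteq> ?\<phi> ` carrier ?R"
    proof
      fix n assume "n \<in> N"
      then show "n \<in> ?\<phi> ` carrier ?R"
        by (intro image_eqI[of _ _ "Inl n"]) (auto simp: Rees_def)
    qed
    \<comment> \<open>\<open>c\<close> may be the middle entry of a triple because it is the unit of
      the local divisor.\<close>
    show "c \<in> ?\<phi> ` carrier ?R"
      using one c cL by (intro image_eqI[of _ _ "Inr (\<one>, c, \<one>)"]) (auto simp: Rees_def)
  qed
  with hom show ?thesis
    by (simp add: epi_def)
qed

section \<open>A maximal proper submonoid above the units\<close>

text \<open>Outside a group the units form a proper submonoid, and finiteness gives a maximal proper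
  submonoid \<open>N\<close> above them. Containing the units forces every \<open>c\<close> outside
  \<open>N\<close> to be a nonunit, which is what makes the local divisor at \<open>c\<close>
  smaller.\<close>

lemma maximal_submonoid_containing_Units:
  assumes fin: "finite (carrier G)" and "\<not> group G"
  obtains N c where "submonoid N G" "N \<noteq> carrier G" "c \<in> carrier G" "c \<notin> Units G"
    "\<And>K. submonoid K G \<Longrightarrow> N \<subseteq> K \<Longrightarrow> c \<in> K \<Longrightarrow> K = carrier G"
proof -
  define Q where "Q = {N. submonoid N G \<and> Units G \<subseteq> N \<and> N \<noteq> carrier G}"
  have "Q \<subseteq> Pow (carrier G)"
    using submonoid.mem_carrier by (fastforce simp: Q_def)
  then have "finite Q"
    using fin by (meson finite_Pow_iff finite_subset)
  moreover have "Units G \<in> Q"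
  proof -
    have "Units G \<noteq> carrier G"
      using \<open>\<not> group G\<close> monoid_axioms unfolding group_def group_axioms_def by blast
    moreover have "submonoid (Units G) G"
      by unfold_locales auto
    ultimately show ?thesis
      by (simp add: Q_def)
  qed
  ultimately obtain N where N: "N \<in> Q" and max: "\<And>K. K \<in> Q \<Longrightarrow> N \<subseteq> K \<Longrightarrow> N = K"
    using finite_has_maximal[of Q] by blast
  have sub: "submonoid N G" and "Units G \<subseteq> N" "N \<noteq> carrier G"
    using N by (auto simp: Q_def)
  then obtain c where c: "c \<in> carrier G" "c \<notin> N"
    using submonoid.subset[OF sub] by blast
  show ?thesis
  proof
    show "submonoid N G" "N \<noteq> carrier G" "c \<in> carrier G" "c \<notin> Units G"
      using sub c \<open>Units G \<subseteq> N\<close> \<open>N \<noteq> carrier G\<close> by auto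
    show "K = carrier G" if "submonoid K G" "N \<subseteq> K" "c \<in> K" for K
      using max[of K] that c \<open>Units G \<subseteq> N\<close> by (auto simp: Q_def)
  qed
qed

end

section \<open>Induction inside a variety closed under Rees extensions\<close>

text \<open>The inverse bijection is the epimorphism. This turns membership up to isomorphism, as in
  \<open>belongs_to\<close>, into a statement about divisors, under which varieties are
  closed.\<close>

lemma iso_divides_monoid:
  assumes R: "monoid R" and "monoid R'" and iso: "R \<cong> R'"
  shows "divides_monoid R R'"
proof -
  obtain g where g: "g \<in> hom R R'" "bij_betw g (carrier R) (carrier R')"
    using iso by (auto simp: is_iso_def iso_def)
  define k where "k = inv_into (carrier R) g"
  have gR: "g ` carrier R = carrier R'"
    using g(2) by (simp add: bij_betw_def)
  have kg: "k (g x) = x" if "x \<in> carrier R" for x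
    using g(2) that by (simp add: k_def bij_betw_def)
  have "k (x \<otimes>\<^bsub>R'\<^esub> y) = k x \<otimes>\<^bsub>R\<^esub> k y"
    if xy: "x \<in> carrier R'" "y \<in> carrier R'" for x y
  proof -
    obtain u v where uv: "u \<in> carrier R" "v \<in> carrier R" "x = g u" "y = g v"
      using xy gR by blast
    then have "k (x \<otimes>\<^bsub>R'\<^esub> y) = k (g (u \<otimes>\<^bsub>R\<^esub> v))"
      using hom_mult[OF g(1)] by simp
    also have "\<dots> = k x \<otimes>\<^bsub>R\<^esub> k y"
      using uv kg monoid.m_closed[OF R] by simp
    finally show ?thesis .
  qed
  moreover have "k ` carrier R' = carrier R"
    unfolding gR[symmetric] image_image using kg by simp
  ultimately have "k \<in> epi R' R"
    by (auto simp: epi_def hom_def)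
  then show ?thesis
    using assms by (intro epi_divides_monoid)
qed

text \<open>Every variety \<open>W\<close> in the defining intersection contains an isomorphic copy
  \<open>R'\<close> of the Rees extension. By transitivity \<open>M\<close> divides
  \<open>R'\<close>, so \<open>M\<close> itself lies in \<open>W\<close>.\<close>

lemma Rees_variety_divisor:
  assumes "N \<in> U" "L \<in> V" "monoid N" "monoid L" and \<rho>: "\<rho> \<in> carrier N \<rightarrow> carrier L"
    and div: "divides_monoid M (Rees N L \<rho>)"
  shows "M \<in> Rees_variety U V"
  unfolding Rees_variety_def variety_generated_by_def
proof safe
  fix W
  assume W: "monoid_variety W"
    and "\<forall>R\<in>{Rees N M \<rho> |N M \<rho>. N \<in> U \<and> M \<in> V \<and> \<rho> \<in> carrier N \<rightarrow> carrier M}. belongs_to R W"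
  then have "belongs_to (Rees N L \<rho>) W"
    using assms by blast
  then obtain R' where R': "R' \<in> W" "Rees N L \<rho> \<cong> R'"
    by (auto simp: belongs_to_def)
  have "monoid R'"
    using W R' by (auto simp: monoid_variety_def finite_monoid_def)
  then have "divides_monoid (Rees N L \<rho>) R'"
    using iso_divides_monoid Rees_monoid R' assms by blast
  then have "divides_monoid M R'"
    by (rule divides_monoid_trans[OF div])
  then show "M \<in> W"
    using W R' by (auto simp: monoid_variety_def)
qed

text \<open>The premise speaks of group divisors rather than subgroups so that it passes, by
  transitivity, from \<open>M\<close> to each of its divisors. This lets the induction hypothesis
  apply to both the submonoid and the local divisor.\<close>

lemma in_variety_if_group_divisors:
  assumes idem: "Rees_variety V V \<subseteq> V"
  shows "finite_monoid M \<Longrightarrow> (\<And>G :: nat monoid. group G \<Longrightarrow> divides_monoid G M \<Longrightarrow> G \<in> V) \<Longrightarrow> M \<in> V"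
proof (induction "card (carrier M)" arbitrary: M rule: less_induct)
  case less
  interpret M: monoid M
    using less.prems(1) by (simp add: finite_monoid_def)
  have fin: "finite (carrier M)"
    using less.prems(1) by (simp add: finite_monoid_def)
  have smaller: "D \<in> V" if D: "divides_monoid D M" "carrier D \<subset> carrier M" for D
  proof (rule less.hyps)
    show "card (carrier D) < card (carrier M)"
      using D(2) fin by (simp add: psubset_card_mono)
    show "finite_monoid D"
      using D fin by (auto simp: finite_monoid_def divides_monoid_def intro: finite_subset)
    show "G \<in> V" if "group G" "divides_monoid G D" for G
      using less.prems(2) that D(1) divides_monoid_trans by blast
  qed
  show ?case
  proof (cases "group M")
    case True
    \<comment> \<open>A group is a group divisor of itself, so the premise applies to
      \<open>M\<close>.\<close>
    have "M \<cong> M"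
      by (rule iso_refl)
    then show ?thesis
      using less.prems(2) True iso_divides_monoid M.monoid_axioms by blast
  next
    case False
    then obtain N c where N: "submonoid N M" "N \<noteq> carrier M"
      and c: "c \<in> carrier M" "c \<notin> Units M"
      and gen: "\<And>K. submonoid K M \<Longrightarrow> N \<subseteq> K \<Longrightarrow> c \<in> K \<Longrightarrow> K = carrier M"
      using M.maximal_submonoid_containing_Units[OF fin] by blast
    let ?N = "M\<lparr>carrier := N\<rparr>"
    let ?L = "local_divisor M c"
    let ?\<rho> = "\<lambda>n. c \<otimes>\<^bsub>M\<^esub> n \<otimes>\<^bsub>M\<^esub> c"
    have NM: "N \<subset> carrier M"
      using N submonoid.subset by blast
    have mN: "monoid ?N"
      using submonoid.submonoid_is_monoid[OF N(1) M.monoid_axioms] .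
    have mL: "monoid ?L"
      by (rule M.local_divisor_monoid[OF c(1)])
    have "subsemigroup N M"
      using N(1) by (auto simp: subsemigroup_def submonoid_def)
    \<comment> \<open>A submonoid shares the unit of \<open>M\<close>, so updating the unit field to
      that value changes nothing.\<close>
    then have "divides_monoid ?N M"
      using divides_monoid_subsemigroup[of M N "\<one>\<^bsub>M\<^esub>"] mN M.monoid_axioms by simp
    then have NV: "?N \<in> V"
      using smaller NM by simp
    have LV: "?L \<in> V"
      using smaller[OF M.local_divisor_divides M.local_divisor_proper] c by simp
    have \<rho>: "?\<rho> \<in> carrier ?N \<rightarrow> carrier ?L"
      using M.local_divisor_sandwich[OF c(1)] NM by auto
    have "divides_monoid M (Rees ?N ?L ?\<rho>)"
      using M.Rees_local_divisor_epi[OF N(1) c(1) gen] Rees_monoid[OF mN mL \<rho>] M.monoid_axioms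
      by (intro epi_divides_monoid)
    then show ?thesis
      using Rees_variety_divisor[OF NV LV mN mL \<rho>] idem by blast
  qed
qed

section \<open>Comparing the variety with the monoids whose subgroups lie in it\<close>

theorem theorem15:
  fixes V H :: "nat monoid set"
  assumes "monoid_variety V"
    and "bullet_idempotent V"
    and "H = V \<inter> finite_groups"
  shows "V = overline_class H"
proof
  have closed: "N \<in> V" if "M \<in> V" "divides_monoid N M" for M N
    using assms(1) that by (auto simp: monoid_variety_def)
  show "V \<subseteq> overline_class H"
  proof
    fix M assume M: "M \<in> V"
    then have fm: "finite_monoid M"
      using assms(1) by (auto simp: monoid_variety_def)
    have "M\<lparr>carrier := S, one := e\<rparr> \<in> H"
      if S: "subsemigroup S M" and grp: "group (M\<lparr>carrier := S, one := e\<rparr>)" for S e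
    proof -
      \<comment> \<open>Subgroups of \<open>M\<close> are divisors of \<open>M\<close>, so closure
        of \<open>V\<close> under divisors settles this inclusion.\<close>
      have "divides_monoid (M\<lparr>carrier := S, one := e\<rparr>) M"
        using fm S group.is_monoid[OF grp]
        by (intro divides_monoid_subsemigroup) (auto simp: finite_monoid_def)
      moreover have "finite S"
        using S fm by (auto simp: subsemigroup_def finite_monoid_def intro: finite_subset)
      ultimately show ?thesis
        using closed M grp assms(3) by (auto simp: finite_groups_def)
    qed
    with fm show "M \<in> overline_class H"
      by (auto simp: overline_class_def)
  qed
  show "overline_class H \<subseteq> V"
  proof
    fix M assume M: "M \<in> overline_class H"
    then have fm: "finite_monoid M"
      by (auto simp: overline_class_def)
    have "G \<in> V" if G: "group G" "divides_monoid G M" for G :: "nat monoid"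
    proof -
      \<comment> \<open>Membership of \<open>M\<close> in \<open>overline_class H\<close> controls
        only subgroups. Lifting replaces the group divisor \<open>G\<close> by a subgroup
        \<open>T\<close> of \<open>M\<close> that \<open>G\<close> divides; \<open>T\<close> lies in
        \<open>H\<close>, hence in \<open>V\<close>, and so does \<open>G\<close>.\<close>
      obtain T e where T: "subsemigroup T M" "group (M\<lparr>carrier := T, one := e\<rparr>)"
        and div: "divides_monoid G (M\<lparr>carrier := T, one := e\<rparr>)"
        using group_divisor_lifts[OF fm G] by blast
      have "M\<lparr>carrier := T, one := e\<rparr> \<in> V"
        using M T assms(3) by (auto simp: overline_class_def)
      then show ?thesis
        using closed div by blast
    qed
    moreover have "Rees_variety V V \<subseteq> V"
      using assms(2) by (simp add: bullet_idempotent_def)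
    ultimately show "M \<in> V"
      using in_variety_if_group_divisors fm by blast
  qed
qed

end
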